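(* Let $h\in\omega^\omega$ with $h(n)\geq1$ for all but finitely many $n$. Then $\min\{\mathfrak{b},\mathfrak{d}^{\mathrm{aLc}}_{\omega,h}\}=\min\{\mathfrak{b},\mathrm{minaLc}_h\}$ and $\max\{\mathfrak{d},\mathfrak{b}^{\mathrm{aLc}}_{\omega,h}\}=\max\{\mathfrak{d},\mathrm{supaLc}_h\}$.
   Context: $\mathfrak{b},\mathfrak{d}$ are the unbounding and dominating numbers of $\langle\omega^\omega,\leq^*\rangle$. A natural number $k$ used as a set means $\{0,\dots,k-1\}$; $\omega$ used for $b$ means the constant sequence $\omega$. For $b$ and $h$: $\prod b=\prod_n b(n)$, $\mathcal{S}(b,h)=\prod_n[b(n)]^{\leq h(n)}$; $\varphi\in\mathcal{S}(b,h)$ anti-localizes $y\in\prod b$ if $y(n)\notin\varphi(n)$ for all but finitely many $n$. $\mathfrak{b}^{\mathrm{aLc}}_{b,h}$ is the least size of $F\subseteq\mathcal{S}(b,h)$ such that no $y\in\prod b$ is anti-localized by every member of $F$; $\mathfrak{d}^{\mathrm{aLc}}_{b,h}$ is the least size of $D\subseteq\prod b$ such that every $\varphi\in\mathcal{S}(b,h)$ anti-localizes some $y\in D$. $\mathrm{supaLc}_h=\sup\{\mathfrak{b}^{\mathrm{aLc}}_{b,h}\}$ and $\mathrm{minaLc}_h=\min\{\mathfrak{d}^{\mathrm{aLc}}_{b,h}\}$, where $b$ ranges over $b\in\omega^\omega$ with $h(n)<b(n)$ for all but finitely many $n$. *)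

theory Defs
  imports Complex_Main "HOL-Library.Equipollence" "HOL-Library.FuncSet" "HOL-Library.Infinite_Set"
begin

section \<open>Cardinal numbers as values\<close>

text \<open>
  A cardinal is an equipollence class of sets of elements of \<^typ>\<open>nat set set\<close>, so the type contains
  all cardinals up to \<open>2\<^bsup>\<cc>\<^esup>\<close>, where \<open>\<cc>\<close> is the size of the continuum. All sets measured below
  have size at most \<open>\<cc>\<close>; hence the top element is larger than all of them and, being the
  infimum of the empty set, it plays the role of the value \<open>\<infinity>\<close> of a ``least size'' when there is no
  set of the required kind.
\<close>

quotient_type cardinal = "nat set set set" / "(\<approx>)"
  by (intro equivpI reflpI sympI transpI) (auto intro: eqpoll_sym eqpoll_trans)

lemma lepoll_eqpoll_cong:
  assumes "A \<approx> A'" "B \<approx> B'"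
  shows "A \<lesssim> B \<longleftrightarrow> A' \<lesssim> B'"
  using assms by (meson eqpoll_sym lepoll_trans1 lepoll_trans2)

lemma lepoll_iff_ordLeq: "A \<lesssim> B \<longleftrightarrow> ordLeq3 (card_of A) (card_of B)"
  unfolding lepoll_def by (rule card_of_ordLeq)

lemma lepoll_linear: "A \<lesssim> B \<or> B \<lesssim> A"
  unfolding lepoll_iff_ordLeq by (rule ordLeq_total[OF card_of_Well_order card_of_Well_order])

instantiation cardinal :: linorder
begin

lift_definition less_eq_cardinal :: "cardinal \<Rightarrow> cardinal \<Rightarrow> bool" is "(\<lesssim>)"
  by (rule lepoll_eqpoll_cong)

definition less_cardinal :: "cardinal \<Rightarrow> cardinal \<Rightarrow> bool" where
  "x < y \<longleftrightarrow> x \<le> y \<and> \<not> y \<le> (x::cardinal)"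

instance
proof
  fix x y z :: cardinal
  show "x < y \<longleftrightarrow> x \<le> y \<and> \<not> y \<le> x" by (rule less_cardinal_def)
  show "x \<le> x" by transfer simp
  show "x \<le> y \<Longrightarrow> y \<le> z \<Longrightarrow> x \<le> z" by transfer (rule lepoll_trans)
  show "x \<le> y \<Longrightarrow> y \<le> x \<Longrightarrow> x = y" by transfer (rule lepoll_antisym)
  show "x \<le> y \<or> y \<le> x" by transfer (rule lepoll_linear)
qed

end

instance cardinal :: wellorder
proof
  fix P :: "cardinal \<Rightarrow> bool" and a :: cardinal
  assume step: "\<And>x. (\<And>y. y < x \<Longrightarrow> P y) \<Longrightarrow> P x"
  let ?R = "inv_image ordLess (\<lambda>A :: nat set set set. card_of A)"
  have wf: "wf ?R" by (intro wf_inv_image wf_ordLess)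
  have "P (abs_cardinal A)" for A
    using wf
  proof (induction A rule: wf_induct_rule)
    case (less A)
    show ?case
    proof (rule step)
      fix y assume y: "y < abs_cardinal A"
      obtain B where B: "y = abs_cardinal B"
        by (rule that[OF Quotient3_abs_rep[OF Quotient3_cardinal, symmetric]])
      have "\<not> A \<lesssim> B"
        using y unfolding B less_cardinal_def less_eq_cardinal.abs_eq by blast
      then have "(B, A) \<in> ?R"
        by (simp add: lepoll_iff_ordLeq not_ordLeq_iff_ordLess[OF card_of_Well_order card_of_Well_order])
      then show "P y" unfolding B by (rule less)
    qed
  qed
  from this[of "rep_cardinal a"] show "P a"
    by (simp only: Quotient3_abs_rep[OF Quotient3_cardinal])
qed

instantiation cardinal :: complete_linorder
begin

lift_definition bot_cardinal :: cardinal is "{}" .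
lift_definition top_cardinal :: cardinal is UNIV .
definition inf_cardinal :: "cardinal \<Rightarrow> cardinal \<Rightarrow> cardinal" where "inf_cardinal = min"
definition sup_cardinal :: "cardinal \<Rightarrow> cardinal \<Rightarrow> cardinal" where "sup_cardinal = max"
definition Inf_cardinal :: "cardinal set \<Rightarrow> cardinal" where
  "Inf_cardinal K = (if K = {} then top else (LEAST x. x \<in> K))"
definition Sup_cardinal :: "cardinal set \<Rightarrow> cardinal" where
  "Sup_cardinal K = (LEAST u. \<forall>x\<in>K. x \<le> u)"

instance
proof
  have top: "x \<le> top" for x :: cardinal
    by transfer (simp add: subset_imp_lepoll)
  have bot: "bot \<le> x" for x :: cardinal
    by transfer simp
  fix x y z :: cardinal and K :: "cardinal set"
  show "inf x y \<le> x" "inf x y \<le> y" "x \<le> sup x y" "y \<le> sup x y"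
    by (auto simp: inf_cardinal_def sup_cardinal_def)
  show "x \<le> y \<Longrightarrow> x \<le> z \<Longrightarrow> x \<le> inf y z" "y \<le> x \<Longrightarrow> z \<le> x \<Longrightarrow> sup y z \<le> x"
    by (auto simp: inf_cardinal_def sup_cardinal_def)
  show "Inf K \<le> x" if "x \<in> K"
    using that Least_le[of "\<lambda>x. x \<in> K" x] by (auto simp only: Inf_cardinal_def split: if_split)
  show "z \<le> Inf K" if "\<And>x. x \<in> K \<Longrightarrow> z \<le> x"
  proof (cases "K = {}")
    case False
    then have "(LEAST x. x \<in> K) \<in> K" using LeastI_ex[of "\<lambda>x. x \<in> K"] by blast
    then show ?thesis using that False by (simp add: Inf_cardinal_def)
  qed (simp add: Inf_cardinal_def top)
  have "\<forall>x\<in>K. x \<le> Sup K"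
    unfolding Sup_cardinal_def
    by (rule LeastI[of "\<lambda>u. \<forall>x\<in>K. x \<le> u" top]) (simp add: top)
  then show "x \<in> K \<Longrightarrow> x \<le> Sup K" by blast
  show "Sup K \<le> z" if "\<And>x. x \<in> K \<Longrightarrow> x \<le> z"
    unfolding Sup_cardinal_def by (rule Least_le) (use that in blast)
  show "Inf {} = (top :: cardinal)" by (simp add: Inf_cardinal_def)
  show "Sup {} = (bot :: cardinal)"
    unfolding Sup_cardinal_def by (rule Least_equality) (simp_all add: bot)
qed

end

text \<open>The size of a set of any type; meaningful for sets that embed into \<^typ>\<open>nat set set\<close>.\<close>

definition csize :: "'a set \<Rightarrow> cardinal" where
  "csize A = abs_cardinal (SOME B. B \<approx> A)"

lemma csize_representative:
  assumes "A \<lesssim> (UNIV :: nat set set set)"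
  shows "(SOME B :: nat set set set. B \<approx> A) \<approx> A"
proof -
  from assms obtain f :: "'a \<Rightarrow> nat set set" where "inj_on f A"
    unfolding lepoll_def by (elim exE conjE)
  then have "f ` A \<approx> A" by (rule inj_on_image_eqpoll_self)
  then show ?thesis by (rule someI)
qed

lemma csize_le_iff:
  fixes A :: "'a set" and B :: "'b set"
  assumes "A \<lesssim> (UNIV :: nat set set set)" "B \<lesssim> (UNIV :: nat set set set)"
  shows "csize A \<le> csize B \<longleftrightarrow> A \<lesssim> B"
proof -
  have "(SOME X :: nat set set set. X \<approx> A) \<approx> A" "(SOME X :: nat set set set. X \<approx> B) \<approx> B"
    using assms by (simp_all only: csize_representative)
  then show ?thesis
    unfolding csize_def less_eq_cardinal.abs_eq by (rule lepoll_eqpoll_cong)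
qed

lemma lepoll_UNIV_slalom: "(A :: (nat \<Rightarrow> nat set) set) \<lesssim> (UNIV :: nat set set set)"
proof -
  let ?g = "\<lambda>f :: nat \<Rightarrow> nat set. {{prod_encode (n, k)} | n k. k \<in> f n}"
  have "inj ?g"
  proof (rule injI)
    fix f f' assume eq: "?g f = ?g f'"
    have mem: "({prod_encode (n, k)} \<in> ?g f) = (k \<in> f n)" for f :: "nat \<Rightarrow> nat set" and n k by auto
    show "f = f'"
    proof (intro ext set_eqI)
      fix n k
      show "k \<in> f n \<longleftrightarrow> k \<in> f' n"
        using mem[of n k f] mem[of n k f'] unfolding eq by (rule trans[OF sym])
    qed
  qed
  then show ?thesis unfolding lepoll_def by (meson inj_on_subset subset_UNIV)
qed

lemma lepoll_UNIV_seq: "(A :: (nat \<Rightarrow> nat) set) \<lesssim> (UNIV :: nat set set set)"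
proof -
  have "inj (\<lambda>(f :: nat \<Rightarrow> nat) n. {f n})" by (auto simp: inj_def fun_eq_iff)
  then have "A \<lesssim> (UNIV :: (nat \<Rightarrow> nat set) set)"
    unfolding lepoll_def by (meson inj_on_subset subset_UNIV)
  then show ?thesis using lepoll_UNIV_slalom lepoll_trans by blast
qed

section \<open>The cardinal characteristics\<close>

definition unbounding_number :: cardinal where
  "unbounding_number =
     (INF F \<in> {F :: (nat \<Rightarrow> nat) set. \<nexists>y. \<forall>x\<in>F. \<forall>\<^sub>\<infinity>n. x n \<le> y n}. csize F)"

definition dominating_number :: cardinal where
  "dominating_number =
     (INF D \<in> {D :: (nat \<Rightarrow> nat) set. \<forall>x. \<exists>y\<in>D. \<forall>\<^sub>\<infinity>n. x n \<le> y n}. csize D)"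

text \<open>
  The parameter \<open>b\<close> is a sequence of sets: \<open>\<lambda>n. {..<b n}\<close> for \<open>b \<in> \<omega>\<^sup>\<omega>\<close>, and \<open>\<lambda>n. UNIV\<close> for the
  constant sequence \<open>\<omega>\<close>. The product of \<open>b\<close> is \<^term>\<open>Pi UNIV b\<close>.
\<close>

definition slaloms :: "(nat \<Rightarrow> nat set) \<Rightarrow> (nat \<Rightarrow> nat) \<Rightarrow> (nat \<Rightarrow> nat set) set" where
  "slaloms b h = (\<Pi> n\<in>UNIV. {s. s \<subseteq> b n \<and> finite s \<and> card s \<le> h n})"

definition anti_localizes :: "(nat \<Rightarrow> nat set) \<Rightarrow> (nat \<Rightarrow> nat) \<Rightarrow> bool" where
  "anti_localizes \<phi> y \<longleftrightarrow> (\<forall>\<^sub>\<infinity>n. y n \<notin> \<phi> n)"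

definition b_aLc :: "(nat \<Rightarrow> nat set) \<Rightarrow> (nat \<Rightarrow> nat) \<Rightarrow> cardinal" where
  "b_aLc b h =
     (INF F \<in> {F. F \<subseteq> slaloms b h \<and> (\<nexists>y. y \<in> Pi UNIV b \<and> (\<forall>\<phi>\<in>F. anti_localizes \<phi> y))}. csize F)"

definition d_aLc :: "(nat \<Rightarrow> nat set) \<Rightarrow> (nat \<Rightarrow> nat) \<Rightarrow> cardinal" where
  "d_aLc b h =
     (INF D \<in> {D. D \<subseteq> Pi UNIV b \<and> (\<forall>\<phi>\<in>slaloms b h. \<exists>y\<in>D. anti_localizes \<phi> y)}. csize D)"

definition sup_aLc :: "(nat \<Rightarrow> nat) \<Rightarrow> cardinal" where
  "sup_aLc h = (SUP b \<in> {b. \<forall>\<^sub>\<infinity>n. h n < b n}. b_aLc (\<lambda>n. {..<b n}) h)"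

text \<open>
  The infimum of a nonempty set of cardinals is its minimum. If \<open>b\<close> takes the value \<open>0\<close>, then
  the product of \<open>b\<close> is empty and \<open>d_aLc\<close> is the top element, so such \<open>b\<close> do not affect the minimum.
\<close>

definition min_aLc :: "(nat \<Rightarrow> nat) \<Rightarrow> cardinal" where
  "min_aLc h = (INF b \<in> {b. \<forall>\<^sub>\<infinity>n. h n < b n}. d_aLc (\<lambda>n. {..<b n}) h)"

end

theory Submission
  imports Defs
begin

text \<open>
  Cutting slaloms down to \<open>b\<close> compares the parameter \<open>\<omega>\<close> with every bounded parameter \<open>b\<close>. Conversely,
  a set \<open>D\<close> witnessing \<open>d_aLc\<close> for \<open>\<omega>\<close> is either unbounded, and then has size at least \<open>\<bb>\<close>, or is
  bounded by some \<open>g\<close>, and then, truncated at \<open>g\<close>, witnesses \<open>d_aLc\<close> for some \<open>b > g\<close>. Dually, a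
  union of witnesses of \<open>b_aLc\<close> for \<open>b\<^sub>g > g\<close>, with \<open>g\<close> ranging over a dominating family, is a witness of
  \<open>b_aLc\<close> for \<open>\<omega>\<close>.
\<close>

text \<open>Cardinals are well-ordered, so a nonempty infimum is a least element. This yields
  witnesses of exactly the size named by a cardinal characteristic.\<close>

lemma INF_attained_cardinal:
  fixes f :: "'a \<Rightarrow> cardinal"
  assumes "S \<noteq> {}"
  shows "\<exists>x\<in>S. f x = (INF x\<in>S. f x)"
proof -
  have "(LEAST u. u \<in> f ` S) \<in> f ` S"
    using assms LeastI_ex[of "\<lambda>u. u \<in> f ` S"] by blast
  then have "(INF x\<in>S. f x) \<in> f ` S"
    using assms by (simp add: Inf_cardinal_def)
  then show ?thesis by (metis imageE)
qed

lemma csize_rep_cardinal: "csize (rep_cardinal \<kappa>) = \<kappa>"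
proof -
  have "(SOME B :: nat set set set. B \<approx> rep_cardinal \<kappa>) \<approx> rep_cardinal \<kappa>"
    by (rule someI) (rule eqpoll_refl)
  then have "csize (rep_cardinal \<kappa>) = abs_cardinal (rep_cardinal \<kappa>)"
    unfolding csize_def by (simp add: cardinal.abs_eq_iff)
  then show ?thesis by (simp only: Quotient3_abs_rep[OF Quotient3_cardinal])
qed

text \<open>Replaces a bound by an abstract value with an embedding into a concrete set, where the
  library's cardinal arithmetic applies.\<close>

lemma csize_le_iff_lepoll_rep:
  assumes "A \<lesssim> (UNIV :: nat set set set)"
  shows "csize A \<le> \<kappa> \<longleftrightarrow> A \<lesssim> rep_cardinal \<kappa>"
  using csize_le_iff[OF assms, of "rep_cardinal \<kappa>"]
  by (simp add: csize_rep_cardinal subset_imp_lepoll)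

text \<open>Comparing \<open>csize\<close> values needs both sets to embed into
  \<open>nat set set\<close>. The image type decides how its embedding is found, hence one version
  for slaloms and one for sequences.\<close>

lemma csize_image_le_slaloms:
  fixes F :: "'a set" and f :: "'a \<Rightarrow> nat \<Rightarrow> nat set"
  assumes "F \<lesssim> (UNIV :: nat set set set)"
  shows "csize (f ` F) \<le> csize F"
  using csize_le_iff[OF lepoll_UNIV_slalom assms] image_lepoll by blast

lemma csize_image_le_seqs:
  fixes F :: "'a set" and f :: "'a \<Rightarrow> nat \<Rightarrow> nat"
  assumes "F \<lesssim> (UNIV :: nat set set set)"
  shows "csize (f ` F) \<le> csize F"
  using csize_le_iff[OF lepoll_UNIV_seq assms] image_lepoll by blast

text \<open>The successor of the pointwise sum of a finite family lies strictly above each member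
  everywhere. Infinity of \<open>D\<close> is what makes a union over \<open>D\<close> no larger
  than the bound on its pieces and index set.\<close>

lemma infinite_dominating:
  fixes D :: "(nat \<Rightarrow> nat) set"
  assumes "\<forall>x. \<exists>y\<in>D. \<forall>\<^sub>\<infinity>n. x n \<le> y n"
  shows "infinite D"
proof
  assume fin: "finite D"
  obtain y where y: "y \<in> D" "\<forall>\<^sub>\<infinity>n. Suc (\<Sum>z\<in>D. z n) \<le> y n"
    using assms[rule_format, of "\<lambda>n. Suc (\<Sum>z\<in>D. z n)"] by blast
  have "y n \<le> (\<Sum>z\<in>D. z n)" for n
    using member_le_sum[of y D "\<lambda>z. z n"] fin y(1) by simp
  then have "\<not> Suc (\<Sum>z\<in>D. z n) \<le> y n" for n
    by (simp add: not_le less_Suc_eq_le)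
  with y(2) have "\<forall>\<^sub>\<infinity>n::nat. False" by simp
  then show False by simp
qed

lemma slaloms_Int:
  assumes "\<phi> \<in> slaloms c h"
  shows "(\<lambda>n. \<phi> n \<inter> b n) \<in> slaloms b h"
proof -
  have "card (\<phi> n \<inter> b n) \<le> h n" if "finite (\<phi> n)" "card (\<phi> n) \<le> h n" for n
    using that by (meson Int_lower1 card_mono order_trans)
  with assms show ?thesis by (fastforce simp: slaloms_def)
qed

lemma slaloms_mono: "(\<And>n. b n \<subseteq> c n) \<Longrightarrow> slaloms b h \<subseteq> slaloms c h"
  unfolding slaloms_def by fastforce

text \<open>A sequence inside \<open>b\<close> can never meet the part of a slalom that is cut
  away.\<close>

lemma anti_localizes_Int_iff:
  assumes "y \<in> Pi UNIV b"
  shows "anti_localizes (\<lambda>n. \<phi> n \<inter> b n) y \<longleftrightarrow> anti_localizes \<phi> y"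
  using assms by (auto simp: anti_localizes_def Pi_def)

lemma anti_localizes_cong:
  assumes "\<forall>\<^sub>\<infinity>n. x n = y n"
  shows "anti_localizes \<phi> x \<longleftrightarrow> anti_localizes \<phi> y"
proof -
  have *: "anti_localizes \<phi> v" if "anti_localizes \<phi> u" "\<forall>\<^sub>\<infinity>n. u n = v n" for u v
    using MOST_conjI[OF that[unfolded anti_localizes_def]] unfolding anti_localizes_def
    by (rule MOST_mono) auto
  from assms have "\<forall>\<^sub>\<infinity>n. y n = x n" by (simp add: eq_commute)
  with assms * show ?thesis by blast
qed

lemma MOST_min_eq:
  fixes y g :: "nat \<Rightarrow> nat"
  assumes "\<forall>\<^sub>\<infinity>n. y n \<le> g n"
  shows "\<forall>\<^sub>\<infinity>n. min (y n) (g n) = y n"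
  using assms by (rule MOST_mono) simp

text \<open>The same \<open>D\<close> works for the larger parameter: given a slalom in
  \<open>c\<close>, its trace on \<open>b\<close> anti-localizes some member of \<open>D\<close>,
  and so does the slalom itself.\<close>

lemma d_aLc_antimono:
  assumes "\<And>n. b n \<subseteq> c n"
  shows "d_aLc c h \<le> d_aLc b h"
  unfolding d_aLc_def
proof (rule INF_superset_mono[OF _ order_refl], rule subsetI, clarify, intro CollectI conjI ballI)
  fix D
  assume D: "D \<subseteq> Pi UNIV b" "\<forall>\<phi>\<in>slaloms b h. \<exists>y\<in>D. anti_localizes \<phi> y"
  show "D \<subseteq> Pi UNIV c" using D(1) assms by blast
  fix \<phi> assume "\<phi> \<in> slaloms c h"
  then obtain y where "y \<in> D" "anti_localizes (\<lambda>n. \<phi> n \<inter> b n) y"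
    using D(2) slaloms_Int by blast
  then show "\<exists>y\<in>D. anti_localizes \<phi> y"
    using D(1) anti_localizes_Int_iff by blast
qed

lemma b_aLc_le_csize:
  assumes "F \<subseteq> slaloms b h" "\<And>y. y \<in> Pi UNIV b \<Longrightarrow> \<exists>\<phi>\<in>F. \<not> anti_localizes \<phi> y"
  shows "b_aLc b h \<le> csize F"
  unfolding b_aLc_def by (rule INF_lower) (use assms in blast)

text \<open>Cutting each slalom of a witness for \<open>c\<close> down to \<open>b\<close> gives a
  witness for \<open>b\<close> that is no larger.\<close>

lemma b_aLc_mono:
  assumes "\<And>n. b n \<subseteq> c n"
  shows "b_aLc b h \<le> b_aLc c h"
  unfolding b_aLc_def[of c]
proof (rule INF_greatest)
  fix F
  assume "F \<in> {F. F \<subseteq> slaloms c h \<and> (\<nexists>y. y \<in> Pi UNIV c \<and> (\<forall>\<phi>\<in>F. anti_localizes \<phi> y))}"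
  then have F: "F \<subseteq> slaloms c h" "\<And>y. y \<in> Pi UNIV c \<Longrightarrow> \<exists>\<phi>\<in>F. \<not> anti_localizes \<phi> y"
    by blast+
  let ?G = "(\<lambda>\<phi> n. \<phi> n \<inter> b n) ` F"
  have "?G \<subseteq> slaloms b h" using F(1) slaloms_Int by blast
  moreover have "\<exists>\<phi>\<in>?G. \<not> anti_localizes \<phi> y" if y: "y \<in> Pi UNIV b" for y
  proof -
    have "y \<in> Pi UNIV c" using y assms by blast
    then obtain \<phi> where "\<phi> \<in> F" "\<not> anti_localizes \<phi> y" using F(2) by blast
    then show ?thesis using anti_localizes_Int_iff[OF y] by blast
  qed
  ultimately have "b_aLc b h \<le> csize ?G" by (rule b_aLc_le_csize)
  also have "\<dots> \<le> csize F" by (rule csize_image_le_slaloms[OF lepoll_UNIV_slalom])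
  finally show "b_aLc b h \<le> csize F" .
qed

lemma d_aLc_omega_le_min_aLc: "d_aLc (\<lambda>_. UNIV) h \<le> min_aLc h"
  unfolding min_aLc_def by (intro INF_greatest d_aLc_antimono) simp

lemma sup_aLc_le_b_aLc_omega: "sup_aLc h \<le> b_aLc (\<lambda>_. UNIV) h"
  unfolding sup_aLc_def by (intro SUP_least b_aLc_mono) simp

lemma min_unbounding_min_aLc_le: "min unbounding_number (min_aLc h) \<le> d_aLc (\<lambda>_. UNIV) h"
  unfolding d_aLc_def
proof (rule INF_greatest, clarify)
  fix D :: "(nat \<Rightarrow> nat) set"
  assume D: "\<forall>\<phi>\<in>slaloms (\<lambda>_. UNIV) h. \<exists>y\<in>D. anti_localizes \<phi> y"
  show "min unbounding_number (min_aLc h) \<le> csize D"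
  proof (cases "\<exists>g. \<forall>y\<in>D. \<forall>\<^sub>\<infinity>n. y n \<le> g n")
    case False
    then have "unbounding_number \<le> csize D"
      unfolding unbounding_number_def by (intro INF_lower) blast
    then show ?thesis by (rule min.coboundedI1)
  next
    case True
    then obtain g where g: "\<And>y. y \<in> D \<Longrightarrow> \<forall>\<^sub>\<infinity>n. y n \<le> g n" by blast
    \<comment> \<open>Being above \<open>h\<close> makes \<open>b\<close> admissible in
      \<open>min_aLc\<close>; being strictly above \<open>g\<close> puts every truncation at
      \<open>g\<close> into the product.\<close>
    define b where "b n = Suc (max (g n) (h n))" for n
    let ?E = "(\<lambda>y n. min (y n) (g n)) ` D"
    have "?E \<subseteq> Pi UNIV (\<lambda>n. {..<b n})" by (auto simp: b_def)
    moreover have "\<exists>y\<in>?E. anti_localizes \<phi> y" if "\<phi> \<in> slaloms (\<lambda>n. {..<b n}) h" for \<phi>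
    proof -
      have "\<phi> \<in> slaloms (\<lambda>_. UNIV) h" using that slaloms_mono[of _ "\<lambda>_. UNIV"] by blast
      then obtain y where "y \<in> D" "anti_localizes \<phi> y" using D by blast
      then show ?thesis using anti_localizes_cong[OF MOST_min_eq[OF g]] by blast
    qed
    ultimately have "d_aLc (\<lambda>n. {..<b n}) h \<le> csize ?E"
      unfolding d_aLc_def by (intro INF_lower) blast
    also have "\<dots> \<le> csize D" by (rule csize_image_le_seqs[OF lepoll_UNIV_seq])
    finally have "d_aLc (\<lambda>n. {..<b n}) h \<le> csize D" .
    moreover have "min_aLc h \<le> d_aLc (\<lambda>n. {..<b n}) h"
      unfolding min_aLc_def by (rule INF_lower) (simp add: b_def less_Suc_eq_le)
    ultimately show ?thesis by (meson min.coboundedI2 order_trans)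
  qed
qed

lemma b_aLc_omega_le_max: "b_aLc (\<lambda>_. UNIV) h \<le> max dominating_number (sup_aLc h)"
\<comment> \<open>\<open>top\<close> is the value of an empty infimum. Once it is excluded, every
  admissible \<open>b\<close> has a witness family, of size at most
  \<open>sup_aLc h\<close>.\<close>
proof (cases "sup_aLc h = top")
  case True
  then show ?thesis by (simp add: max_def top_unique)
next
  case False
  let ?dom = "{D :: (nat \<Rightarrow> nat) set. \<forall>x. \<exists>y\<in>D. \<forall>\<^sub>\<infinity>n. x n \<le> y n}"
  have "\<exists>y\<in>UNIV. \<forall>\<^sub>\<infinity>n. x n \<le> y n" for x :: "nat \<Rightarrow> nat"
    by (rule bexI[of _ x]) simp_all
  then have "?dom \<noteq> {}" by blast
  then obtain D :: "(nat \<Rightarrow> nat) set" where D: "\<And>x. \<exists>y\<in>D. \<forall>\<^sub>\<infinity>n. x n \<le> y n" "csize D = dominating_number"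
    using INF_attained_cardinal[of ?dom csize] unfolding dominating_number_def by blast
  define b where "b g n = Suc (max (g n) (h n))" for g :: "nat \<Rightarrow> nat" and n
  have "\<exists>F \<subseteq> slaloms (\<lambda>n. {..<b g n}) h. csize F \<le> sup_aLc h \<and>
      (\<forall>y \<in> Pi UNIV (\<lambda>n. {..<b g n}). \<exists>\<phi>\<in>F. \<not> anti_localizes \<phi> y)" for g
  proof -
    let ?S = "{F. F \<subseteq> slaloms (\<lambda>n. {..<b g n}) h \<and>
      (\<nexists>y. y \<in> Pi UNIV (\<lambda>n. {..<b g n}) \<and> (\<forall>\<phi>\<in>F. anti_localizes \<phi> y))}"
    have le: "b_aLc (\<lambda>n. {..<b g n}) h \<le> sup_aLc h"
      unfolding sup_aLc_def by (rule SUP_upper) (simp add: b_def less_Suc_eq_le)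
    with False have "b_aLc (\<lambda>n. {..<b g n}) h \<noteq> top" by (metis top_unique)
    then have "?S \<noteq> {}" unfolding b_aLc_def by (metis INF_empty)
    then obtain F where F: "F \<in> ?S" "csize F = b_aLc (\<lambda>n. {..<b g n}) h"
      using INF_attained_cardinal[of ?S csize] unfolding b_aLc_def by blast
    have "csize F \<le> sup_aLc h" using F(2) le by simp
    with F(1) show ?thesis by (intro exI[of _ F]) simp_all
  qed
  then obtain F where F: "\<And>g. F g \<subseteq> slaloms (\<lambda>n. {..<b g n}) h" "\<And>g. csize (F g) \<le> sup_aLc h"
      "\<And>g y. y \<in> Pi UNIV (\<lambda>n. {..<b g n}) \<Longrightarrow> \<exists>\<phi>\<in>F g. \<not> anti_localizes \<phi> y"
    by metis
  let ?G = "\<Union>g\<in>D. F g"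
  have "?G \<subseteq> slaloms (\<lambda>_. UNIV) h" using F(1) slaloms_mono[of _ "\<lambda>_. UNIV"] by blast
  moreover have "\<exists>\<phi>\<in>?G. \<not> anti_localizes \<phi> y" for y
  proof -
    obtain g where g: "g \<in> D" "\<forall>\<^sub>\<infinity>n. y n \<le> g n" using D(1) by blast
    \<comment> \<open>The sequence \<open>y\<close> itself may leave the product at finitely many
      places; truncation repairs this and changes only finitely many values.\<close>
    have "(\<lambda>n. min (y n) (g n)) \<in> Pi UNIV (\<lambda>n. {..<b g n})" by (auto simp: b_def)
    then obtain \<phi> where "\<phi> \<in> F g" "\<not> anti_localizes \<phi> (\<lambda>n. min (y n) (g n))"
      using F(3) by blast
    then show ?thesis using g(1) anti_localizes_cong[OF MOST_min_eq[OF g(2)]] by blast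
  qed
  ultimately have "b_aLc (\<lambda>_. UNIV) h \<le> csize ?G" by (rule b_aLc_le_csize)
  also have "\<dots> \<le> max dominating_number (sup_aLc h)" (is "_ \<le> ?\<kappa>")
  proof -
    have D_le: "D \<lesssim> rep_cardinal ?\<kappa>"
      using D(2) csize_le_iff_lepoll_rep[OF lepoll_UNIV_seq] by (metis max.cobounded1)
    \<comment> \<open>The infinite dominating family \<open>D\<close> embeds into this set. A union
      of at most \<open>?\<kappa>\<close> many sets, each of size at most \<open>?\<kappa>\<close>,
      then has size at most \<open>?\<kappa>\<close>.\<close>
    then have "infinite (rep_cardinal ?\<kappa>)"
      using infinite_dominating[of D] D(1) unfolding infinite_le_lepoll by (blast intro: lepoll_trans)
    moreover have "F g \<lesssim> rep_cardinal ?\<kappa>" for g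
      using F(2) csize_le_iff_lepoll_rep[OF lepoll_UNIV_slalom] max.coboundedI2 by blast
    ultimately have "?G \<lesssim> rep_cardinal ?\<kappa>"
      using D_le unfolding lepoll_iff_ordLeq
      by (intro card_of_UNION_ordLeq_infinite) simp_all
    then show ?thesis using csize_le_iff_lepoll_rep[OF lepoll_UNIV_slalom] by blast
  qed
  finally show ?thesis .
qed

theorem theorem3p21:
  fixes h :: "nat \<Rightarrow> nat"
  assumes "\<forall>\<^sub>\<infinity>n. h n \<ge> 1"
  shows "min unbounding_number (d_aLc (\<lambda>_. UNIV) h) = min unbounding_number (min_aLc h)
    \<and> max dominating_number (b_aLc (\<lambda>_. UNIV) h) = max dominating_number (sup_aLc h)"
proof (intro conjI antisym)
  show "min unbounding_number (d_aLc (\<lambda>_. UNIV) h) \<le> min unbounding_number (min_aLc h)"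
    using d_aLc_omega_le_min_aLc by (rule min.mono[OF order_refl])
  show "min unbounding_number (min_aLc h) \<le> min unbounding_number (d_aLc (\<lambda>_. UNIV) h)"
    by (rule min.boundedI[OF min.cobounded1 min_unbounding_min_aLc_le])
  show "max dominating_number (b_aLc (\<lambda>_. UNIV) h) \<le> max dominating_number (sup_aLc h)"
    by (rule max.boundedI[OF max.cobounded1 b_aLc_omega_le_max])
  show "max dominating_number (sup_aLc h) \<le> max dominating_number (b_aLc (\<lambda>_. UNIV) h)"
    using sup_aLc_le_b_aLc_omega by (rule max.mono[OF order_refl])
qed

end
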